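(* Let $\triangleright_a:\mathrm{Lie}(V)\otimes\mathrm{Lie}(V)\to\mathrm{Lie}(V)$ be the map defined in the context. Then $(\mathrm{Lie}(V),[\cdot,\cdot],\triangleright_a)$ is a post-Lie algebra.
   Context: $V=\{v_0,v_1,v_2,\dots\}$. For $\mathbf k=(k_1,\dots,k_d),\mathbf l=(l_1,\dots,l_d)\in\mathbb Z_{\ge0}^d$ set $|\mathbf k|=k_1+\dots+k_d$ and define the ari multiplicity $\mathrm m_{\mathbf k,\mathbf l}=(-1)^{|\mathbf k|+|\mathbf l|}\prod_{i=1}^d\binom{k_i-1}{l_i-1}$, where $\binom{k-1}{l-1}$ is the usual binomial coefficient for $k,l\ge1$ (zero if $l>k$), $\binom{-1}{-1}=1$, and $\binom{k-1}{-1}=\binom{-1}{l-1}=0$ for $k,l>0$; $\mathrm m_{\emptyset,\emptyset}=1$. Let $M(V)$ be the free magma on $V$ with product $\star$ and $M(V)_{\mathbb Q}$ its $\mathbb Q$-span. An element $t\in M(V)$ is a bracketing of letters $v_{k_1},\dots,v_{k_d}$ (in left-to-right order); write $t=t(\mathbf k)$ and let $t(\mathbf l)$ denote the same bracketing with the letters replaced by $v_{l_1},\dots,v_{l_d}$. Define $t(\mathbf k)\triangleright_a v_0=0$ and, for $s\ge1$, $t(\mathbf k)\triangleright_a v_s=\sum_{\mathbf l\in\mathbb Z_{\ge0}^d}\mathrm m_{\mathbf k,\mathbf l}\,v_{s+|\mathbf k|-|\mathbf l|}\star t(\mathbf l)$ (a finite sum). Extend $\triangleright_a$ linearly in the first argument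 and as a derivation of $(M(V)_{\mathbb Q},\star)$ in the second argument. Let $\mathrm{Lie}:M(V)_{\mathbb Q}\to\mathrm{Lie}(V)$ be the surjective homomorphism onto the free Lie algebra which is the identity on $V$ and maps $a\star b\mapsto[a,b]$. Then $\triangleright_a$ descends to a well-defined bilinear map $\triangleright_a$ on $\mathrm{Lie}(V)$ with $\mathrm{Lie}(x\triangleright_a y)=\mathrm{Lie}(x)\triangleright_a\mathrm{Lie}(y)$; this is the map in the claim. A post-Lie algebra is a Lie algebra $(\mathfrak g,[\cdot,\cdot])$ with bilinear $\triangleright$ such that $x\triangleright[y,z]=[x\triangleright y,z]+[y,x\triangleright z]$ and $[x,y]\triangleright z=x\triangleright(y\triangleright z)-(x\triangleright y)\triangleright z-y\triangleright(x\triangleright z)+(y\triangleright x)\triangleright z$. *)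

theory Defs
  imports Complex_Main "HOL-Library.Poly_Mapping"
begin

section \<open>Lie algebras and post-Lie algebras\<close>

locale bilinear_product = vector_space scale
  for scale :: "'k::field \<Rightarrow> 'g::ab_group_add \<Rightarrow> 'g" +
  fixes prd :: "'g \<Rightarrow> 'g \<Rightarrow> 'g"
  assumes linear_right: "Vector_Spaces.linear scale scale (\<lambda>y. prd x y)"
    and linear_left: "Vector_Spaces.linear scale scale (\<lambda>x. prd x y)"

locale lie_algebra = bilinear_product scale brk
  for scale :: "'k::field \<Rightarrow> 'g::ab_group_add \<Rightarrow> 'g"
    and brk :: "'g \<Rightarrow> 'g \<Rightarrow> 'g" +
  assumes alternating: "brk x x = 0"
    and jacobi: "brk x (brk y z) + brk y (brk z x) + brk z (brk x y) = 0"

locale post_lie_algebra = lie_algebra scale brk + tri: bilinear_product scale tri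
  for scale :: "'k::field \<Rightarrow> 'g::ab_group_add \<Rightarrow> 'g"
    and brk :: "'g \<Rightarrow> 'g \<Rightarrow> 'g"
    and tri :: "'g \<Rightarrow> 'g \<Rightarrow> 'g" +
  assumes derivation: "tri x (brk y z) = brk (tri x y) z + brk y (tri x z)"
    and post_lie:
      "tri (brk x y) z = tri x (tri y z) - tri (tri x y) z - tri y (tri x z) + tri (tri y x) z"

section \<open>The free magma and its rational span\<close>

datatype 'v magma = Letter 'v | Op "'v magma" "'v magma"

type_synonym 'v magma_span = "'v magma \<Rightarrow>\<^sub>0 rat"

abbreviation basis :: "'a \<Rightarrow> ('a \<Rightarrow>\<^sub>0 rat)"
  where "basis t \<equiv> Poly_Mapping.single t 1"

definition scale_span :: "rat \<Rightarrow> ('a \<Rightarrow>\<^sub>0 rat) \<Rightarrow> ('a \<Rightarrow>\<^sub>0 rat)"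
  where "scale_span c x = Poly_Mapping.map ((*) c) x"

definition extend_linear :: "('a \<Rightarrow> ('b \<Rightarrow>\<^sub>0 rat)) \<Rightarrow> ('a \<Rightarrow>\<^sub>0 rat) \<Rightarrow> ('b \<Rightarrow>\<^sub>0 rat)"
  where "extend_linear f x =
    (\<Sum>t\<in>Poly_Mapping.keys x. scale_span (Poly_Mapping.lookup x t) (f t))"

definition star :: "'v magma_span \<Rightarrow> 'v magma_span \<Rightarrow> 'v magma_span"
  where "star x y = extend_linear (\<lambda>a. extend_linear (\<lambda>b. basis (Op a b)) y) x"

lemma lookup_scale_span [simp]:
  "Poly_Mapping.lookup (scale_span c x) t = c * Poly_Mapping.lookup x t"
  by (simp add: scale_span_def Poly_Mapping.map.rep_eq when_def)

interpretation span_vs: vector_space scale_span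
  by standard (auto intro!: poly_mapping_eqI simp: lookup_add algebra_simps)

lemma extend_linear_superset:
  assumes "finite A" "Poly_Mapping.keys x \<subseteq> A"
  shows "extend_linear f x = (\<Sum>t\<in>A. scale_span (Poly_Mapping.lookup x t) (f t))"
  unfolding extend_linear_def
  by (rule sum.mono_neutral_left) (use assms in \<open>auto simp: in_keys_iff\<close>)

lemma extend_linear_add: "extend_linear f (x + y) = extend_linear f x + extend_linear f y"
proof -
  let ?A = "Poly_Mapping.keys x \<union> Poly_Mapping.keys y"
  have "Poly_Mapping.keys (x + y) \<subseteq> ?A" by (rule keys_add)
  then show ?thesis
    by (simp add: extend_linear_superset[of ?A] lookup_add span_vs.scale_left_distrib sum.distrib)
qed

lemma extend_linear_scale:
  "extend_linear f (scale_span c x) = scale_span c (extend_linear f x)"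
proof -
  have "Poly_Mapping.keys (scale_span c x) \<subseteq> Poly_Mapping.keys x" by (auto simp: in_keys_iff)
  then show ?thesis
    by (simp add: extend_linear_superset[of "Poly_Mapping.keys x"] span_vs.scale_sum_right)
qed

lemma linear_extend_linear [simp, intro]:
  "Vector_Spaces.linear scale_span scale_span (extend_linear f)"
  by unfold_locales (auto simp: extend_linear_add extend_linear_scale)

lemma extend_linear_single [simp]: "extend_linear f (Poly_Mapping.single t c) = scale_span c (f t)"
  by (cases "c = 0") (auto simp: extend_linear_def)

lemma extend_linear_sum: "extend_linear f (sum g A) = (\<Sum>a\<in>A. extend_linear f (g a))"
  by (rule module_hom.sum[OF Vector_Spaces.linear.axioms(3)[OF linear_extend_linear]])

lemma extend_linear_zero [simp]: "extend_linear f 0 = 0"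
  by (simp add: extend_linear_def)

lemma extend_linear_diff: "extend_linear f (x - y) = extend_linear f x - extend_linear f y"
  by (metis extend_linear_add add_diff_cancel diff_add_cancel)

lemma extend_linear_fun_add:
  "extend_linear (\<lambda>t. f t + g t) x = extend_linear f x + extend_linear g x"
  by (simp add: extend_linear_def span_vs.scale_right_distrib sum.distrib)

lemma extend_linear_fun_scale:
  "extend_linear (\<lambda>t. scale_span c (f t)) x = scale_span c (extend_linear f x)"
  by (simp add: extend_linear_def span_vs.scale_sum_right mult.commute)

lemma extend_linear_fun_sum:
  "extend_linear (\<lambda>t. \<Sum>a\<in>A. f a t) x = (\<Sum>a\<in>A. extend_linear (f a) x)"
  unfolding extend_linear_def span_vs.scale_sum_right by (rule sum.swap)

lemma extend_linear_fun_zero [simp]: "extend_linear (\<lambda>t. 0) x = 0"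
  by (simp add: extend_linear_def)

lemma extend_linear_extend_linear:
  "extend_linear g (extend_linear f x) = extend_linear (\<lambda>t. extend_linear g (f t)) x"
  by (simp add: extend_linear_def[of f] extend_linear_def[of "\<lambda>t. extend_linear g (f t)"]
      extend_linear_sum extend_linear_scale)

lemma span_expand: "x = extend_linear basis x"
  by (rule poly_mapping_eqI)
    (auto simp: extend_linear_def lookup_sum lookup_single when_def in_keys_iff if_distrib cong: if_cong)

lemma span_induct [case_names zero add scale basis]:
  assumes "P 0" "\<And>x y. P x \<Longrightarrow> P y \<Longrightarrow> P (x + y)"
    "\<And>c x. P x \<Longrightarrow> P (scale_span c x)" "\<And>t. P (Poly_Mapping.single t 1)"
  shows "P x"
proof -
  have "P (\<Sum>t\<in>A. scale_span (Poly_Mapping.lookup x t) (basis t))" if "finite A" for A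
    using that by induction (auto intro: assms)
  then show ?thesis by (subst span_expand) (simp add: extend_linear_def)
qed

lemma star_basis [simp]: "star (basis a) (basis b) = basis (Op a b)"
  by (simp add: star_def)

lemma star_add_left: "star (x + y) z = star x z + star y z"
  and star_scale_left: "star (scale_span c x) z = scale_span c (star x z)"
  and star_zero_left [simp]: "star 0 z = 0"
  and star_diff_left: "star (x - y) z = star x z - star y z"
  by (simp_all add: star_def extend_linear_add extend_linear_scale extend_linear_diff)

lemma star_add_right: "star z (x + y) = star z x + star z y"
  and star_scale_right: "star z (scale_span c x) = scale_span c (star z x)"
  and star_zero_right [simp]: "star z 0 = 0"
  by (simp_all add: star_def extend_linear_add extend_linear_scale extend_linear_fun_add
      extend_linear_fun_scale)

lemma star_diff_right: "star z (x - y) = star z x - star z y"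
  by (metis star_add_right add_diff_cancel diff_add_cancel)

lemma star_sum_left: "star (sum f A) z = (\<Sum>a\<in>A. star (f a) z)"
  by (simp add: star_def extend_linear_sum)

lemma star_sum_right: "star z (sum f A) = (\<Sum>a\<in>A. star z (f a))"
  by (induction A rule: infinite_finite_induct) (auto simp: star_add_right)

section \<open>The free Lie algebra\<close>

text \<open>The free Lie algebra is the quotient of the free nonassociative algebra by the two-sided
  ideal generated by the squares and the Jacobiators.\<close>

inductive_set lie_ideal :: "'v magma_span set" where
  square: "star x x \<in> lie_ideal"
| jacobi: "star x (star y z) + star y (star z x) + star z (star x y) \<in> lie_ideal"
| zero: "0 \<in> lie_ideal"
| add: "x \<in> lie_ideal \<Longrightarrow> y \<in> lie_ideal \<Longrightarrow> x + y \<in> lie_ideal"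
| scale: "x \<in> lie_ideal \<Longrightarrow> scale_span c x \<in> lie_ideal"
| left: "x \<in> lie_ideal \<Longrightarrow> star y x \<in> lie_ideal"
| right: "x \<in> lie_ideal \<Longrightarrow> star x y \<in> lie_ideal"

lemma lie_ideal_uminus: "x \<in> lie_ideal \<Longrightarrow> - x \<in> lie_ideal"
  using lie_ideal.scale[of x "-1"] by simp

lemma lie_ideal_diff: "x \<in> lie_ideal \<Longrightarrow> y \<in> lie_ideal \<Longrightarrow> x - y \<in> lie_ideal"
  using lie_ideal.add[OF _ lie_ideal_uminus, of x y] by simp

lemma lie_ideal_sum: "(\<And>a. a \<in> A \<Longrightarrow> f a \<in> lie_ideal) \<Longrightarrow> sum f A \<in> lie_ideal"
  by (induction A rule: infinite_finite_induct) (auto intro: lie_ideal.intros)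

lemma lie_ideal_antisym: "star x y + star y x \<in> lie_ideal"
proof -
  have "star (x + y) (x + y) - star x x - star y y \<in> lie_ideal"
    by (intro lie_ideal_diff lie_ideal.square)
  then show ?thesis by (simp add: star_add_left star_add_right algebra_simps)
qed

definition lie_rel :: "'v magma_span \<Rightarrow> 'v magma_span \<Rightarrow> bool"
  where "lie_rel x y \<longleftrightarrow> x - y \<in> lie_ideal"

lemma equivp_lie_rel: "equivp lie_rel"
proof (rule equivpI)
  show "reflp lie_rel" by (auto intro!: reflpI simp: lie_rel_def lie_ideal.zero)
  show "symp lie_rel" by (rule sympI) (metis lie_rel_def lie_ideal_uminus minus_diff_eq)
  show "transp lie_rel"
    by (rule transpI) (use lie_ideal.add in \<open>fastforce simp: lie_rel_def\<close>)
qed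

quotient_type 'v free_lie = "'v magma_span" / lie_rel
  morphisms rep_lie Lie
  by (rule equivp_lie_rel)

instantiation free_lie :: (type) ab_group_add
begin

lift_definition zero_free_lie :: "'a free_lie" is 0 .

lift_definition plus_free_lie :: "'a free_lie \<Rightarrow> 'a free_lie \<Rightarrow> 'a free_lie" is "(+)"
proof -
  fix a b c d :: "'a magma_span"
  assume "lie_rel a b" "lie_rel c d"
  then have "(a - b) + (c - d) \<in> lie_ideal" unfolding lie_rel_def by (rule lie_ideal.add)
  then show "lie_rel (a + c) (b + d)" by (simp add: lie_rel_def algebra_simps)
qed

lift_definition uminus_free_lie :: "'a free_lie \<Rightarrow> 'a free_lie" is uminus
proof -
  fix a b :: "'a magma_span"
  assume "lie_rel a b"
  then have "- (a - b) \<in> lie_ideal" unfolding lie_rel_def by (rule lie_ideal_uminus)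
  then show "lie_rel (- a) (- b)" by (simp add: lie_rel_def)
qed

lift_definition minus_free_lie :: "'a free_lie \<Rightarrow> 'a free_lie \<Rightarrow> 'a free_lie" is "(-)"
proof -
  fix a b c d :: "'a magma_span"
  assume "lie_rel a b" "lie_rel c d"
  then have "(a - b) - (c - d) \<in> lie_ideal" unfolding lie_rel_def by (rule lie_ideal_diff)
  then show "lie_rel (a - c) (b - d)" by (simp add: lie_rel_def algebra_simps)
qed

instance
proof
  fix a b c :: "'a free_lie"
  show "a + b + c = a + (b + c)"
    by transfer (simp add: lie_rel_def lie_ideal.zero add.assoc)
  show "a + b = b + a"
    by transfer (simp add: lie_rel_def lie_ideal.zero add.commute)
  show "0 + a = a" "- a + a = 0" "a - b = a + - b"
    by (transfer, simp add: lie_rel_def lie_ideal.zero)+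
qed

end

lift_definition scale_lie :: "rat \<Rightarrow> 'v free_lie \<Rightarrow> 'v free_lie" is scale_span
  unfolding lie_rel_def span_vs.scale_right_diff_distrib[symmetric] by (rule lie_ideal.scale)

lift_definition bracket :: "'v free_lie \<Rightarrow> 'v free_lie \<Rightarrow> 'v free_lie" is star
proof -
  fix a b c d :: "'v magma_span"
  assume "lie_rel a b" "lie_rel c d"
  then have "star (a - b) c + star b (c - d) \<in> lie_ideal"
    unfolding lie_rel_def by (blast intro: lie_ideal.add lie_ideal.left lie_ideal.right)
  then show "lie_rel (star a c) (star b d)"
    by (simp add: lie_rel_def star_diff_left star_diff_right)
qed

section \<open>The ari post-Lie product\<close>

text \<open>\<^term>\<open>ari_binom k l\<close> is the binomial coefficient \<open>k - 1\<close> over \<open>l - 1\<close>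
  with the conventions at \<open>k = 0\<close> or \<open>l = 0\<close>.\<close>

fun ari_binom :: "nat \<Rightarrow> nat \<Rightarrow> nat" where
  "ari_binom 0 0 = 1"
| "ari_binom (Suc k) (Suc l) = k choose l"
| "ari_binom _ _ = 0"

definition ari_mult :: "nat list \<Rightarrow> nat list \<Rightarrow> rat"
  where "ari_mult k l =
    (-1) ^ (sum_list k + sum_list l) * (\<Prod>i<length k. of_nat (ari_binom (k ! i) (l ! i)))"

primrec letters :: "'v magma \<Rightarrow> 'v list" where
  "letters (Letter v) = [v]"
| "letters (Op a b) = letters a @ letters b"

text \<open>\<open>relabel t l\<close> is the bracketing of \<open>t\<close> with its letters replaced, from left to right,
  by \<open>l\<close>; it is only meaningful if \<open>l\<close> has as many entries as \<open>t\<close> has letters.\<close>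

primrec relabel :: "'v magma \<Rightarrow> 'v list \<Rightarrow> 'v magma" where
  "relabel (Letter v) l = Letter (hd l)"
| "relabel (Op a b) l =
    Op (relabel a (take (length (letters a)) l)) (relabel b (drop (length (letters a)) l))"

lemma letters_relabel: "length l = length (letters t) \<Longrightarrow> letters (relabel t l) = l"
  by (induction t arbitrary: l) (auto simp: length_Suc_conv)

lemma relabel_letters: "relabel t (letters t) = t"
  by (induction t) auto

text \<open>The multiplicity vanishes unless every \<open>l ! i \<le> k ! i\<close>; restricting to
  non-zero multiplicities makes the index set finite and the subtraction
  \<open>|k| - |l|\<close> exact.\<close>

definition ari_support :: "nat list \<Rightarrow> nat list set"
  where "ari_support k = {l. length l = length k \<and> ari_mult k l \<noteq> 0}"

primrec tri_basis :: "nat magma \<Rightarrow> nat magma \<Rightarrow> nat magma_span" where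
  "tri_basis t (Letter s) =
    (if s = 0 then 0
     else \<Sum>l\<in>ari_support (letters t). scale_span (ari_mult (letters t) l)
        (star (basis (Letter (s + sum_list (letters t) - sum_list l))) (basis (relabel t l))))"
| "tri_basis t (Op a b) = star (tri_basis t a) (basis b) + star (basis a) (tri_basis t b)"

definition tri_span :: "nat magma_span \<Rightarrow> nat magma_span \<Rightarrow> nat magma_span"
  where "tri_span x y = extend_linear (\<lambda>t. extend_linear (tri_basis t) y) x"

subsection \<open>Finiteness of the support\<close>

lemma ari_binom_eq_0: "k < l \<Longrightarrow> ari_binom k l = 0"
  by (cases "(k, l)" rule: ari_binom.cases) auto

lemma ari_mult_Nil [simp]: "ari_mult [] l = (-1) ^ sum_list l"
  by (simp add: ari_mult_def)

lemma ari_mult_Cons: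
  "ari_mult (k # ks) (l # ls) = (-1) ^ (k + l) * of_nat (ari_binom k l) * ari_mult ks ls"
  by (simp add: ari_mult_def prod.lessThan_Suc_shift power_add mult_ac del: prod.lessThan_Suc)

lemma ari_mult_append:
  "length l = length k \<Longrightarrow> ari_mult (k @ k') (l @ l') = ari_mult k l * ari_mult k' l'"
proof (induction l k rule: list_induct2)
  case Nil
  then show ?case by (simp add: ari_mult_def)
next
  case (Cons x xs y ys)
  then show ?case by (simp add: ari_mult_Cons)
qed

lemma ari_support_le: "l \<in> ari_support k \<Longrightarrow> list_all2 (\<le>) l k"
  unfolding list_all2_conv_all_nth
proof (intro conjI allI impI)
  assume l: "l \<in> ari_support k"
  then show "length l = length k" by (simp add: ari_support_def)
  fix i assume "i < length l"
  then have "ari_binom (k ! i) (l ! i) \<noteq> 0"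
    using l by (simp add: ari_support_def ari_mult_def)
  then show "l ! i \<le> k ! i" using ari_binom_eq_0 not_less by blast
qed

lemma sum_list_mono2': "list_all2 (\<le>) l k \<Longrightarrow> sum_list l \<le> sum_list (k :: nat list)"
  by (induction rule: list_all2_induct) auto

lemma ari_support_sum_le: "l \<in> ari_support k \<Longrightarrow> sum_list l \<le> sum_list k"
  by (intro sum_list_mono2' ari_support_le)

lemma finite_ari_support: "finite (ari_support k)"
proof (rule finite_subset)
  show "ari_support k \<subseteq> {l. set l \<subseteq> {..sum_list k} \<and> length l = length k}"
  proof
    fix l assume l: "l \<in> ari_support k"
    have "x \<le> sum_list k" if "x \<in> set l" for x
      using member_le_sum_list[OF that] ari_support_sum_le[OF l] by linarith
    then show "l \<in> {l. set l \<subseteq> {..sum_list k} \<and> length l = length k}"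
      using l by (auto simp: ari_support_def)
  qed
  show "finite {l. set l \<subseteq> {..sum_list k} \<and> length l = length k}"
    by (rule finite_lists_length_eq) auto
qed

subsection \<open>The product descends to the free Lie algebra\<close>

lemma tri_span_add_left: "tri_span (x + y) z = tri_span x z + tri_span y z"
  and tri_span_scale_left: "tri_span (scale_span c x) z = scale_span c (tri_span x z)"
  and tri_span_diff_left: "tri_span (x - y) z = tri_span x z - tri_span y z"
  and tri_span_zero_left [simp]: "tri_span 0 z = 0"
  by (simp_all add: tri_span_def extend_linear_add extend_linear_scale extend_linear_diff)

lemma tri_span_add_right: "tri_span z (x + y) = tri_span z x + tri_span z y"
  and tri_span_scale_right: "tri_span z (scale_span c x) = scale_span c (tri_span z x)"
  and tri_span_zero_right [simp]: "tri_span z 0 = 0"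
  by (simp_all add: tri_span_def extend_linear_add extend_linear_scale extend_linear_fun_add
      extend_linear_fun_scale)

lemma tri_span_diff_right: "tri_span z (x - y) = tri_span z x - tri_span z y"
  by (metis tri_span_add_right add_diff_cancel diff_add_cancel)

lemma tri_span_basis [simp]: "tri_span (basis t) (basis u) = tri_basis t u"
  by (simp add: tri_span_def)

lemma tri_span_star: "tri_span x (star y z) = star (tri_span x y) z + star y (tri_span x z)"
proof (induction x rule: span_induct)
  case (basis t)
  show ?case
  proof (induction y rule: span_induct)
    case (basis a)
    show ?case
    proof (induction z rule: span_induct)
      case (basis b)
      show ?case by simp
    qed (simp_all add: tri_span_add_right star_add_right tri_span_scale_right star_scale_right
        span_vs.scale_right_distrib)
  qed (simp_all add: tri_span_add_right star_add_left star_add_right tri_span_scale_right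
      star_scale_left star_scale_right span_vs.scale_right_distrib)
qed (simp_all add: tri_span_add_left star_add_left star_add_right tri_span_scale_left
    star_scale_left star_scale_right span_vs.scale_right_distrib)

lemma tri_span_ideal_right: "y \<in> lie_ideal \<Longrightarrow> tri_span x y \<in> lie_ideal"
proof (induction rule: lie_ideal.induct)
  case (square y)
  then show ?case by (simp add: tri_span_star lie_ideal_antisym)
next
  case (jacobi y z w)
  let ?J = "\<lambda>y z w. star y (star z w) + star z (star w y) + star w (star y z)"
  have "tri_span x (?J y z w) = ?J (tri_span x y) z w + ?J y (tri_span x z) w + ?J y z (tri_span x w)"
    by (simp add: tri_span_star tri_span_add_right star_add_right algebra_simps)
  then show ?case by (auto intro: lie_ideal.intros)
qed (auto simp: tri_span_add_right tri_span_scale_right tri_span_star intro: lie_ideal.intros)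

text \<open>The part of \<open>t(k) \<mapsto> \<Sum>\<^sub>l m\<^sub>k\<^sub>,\<^sub>l t(l)\<close> lowering the total index by \<open>j\<close>. Summed over
  \<open>j\<close> against a formal variable, these maps form an algebra homomorphism.\<close>

definition lower_set :: "nat \<Rightarrow> nat magma \<Rightarrow> nat list set"
  where "lower_set j t = {l \<in> ari_support (letters t). sum_list l + j = sum_list (letters t)}"

definition lower_basis :: "nat \<Rightarrow> nat magma \<Rightarrow> nat magma_span"
  where "lower_basis j t =
    (\<Sum>l\<in>lower_set j t. scale_span (ari_mult (letters t) l) (basis (relabel t l)))"

definition lower :: "nat \<Rightarrow> nat magma_span \<Rightarrow> nat magma_span"
  where "lower j = extend_linear (lower_basis j)"

lemma finite_lower_set: "finite (lower_set j t)"
  by (auto simp: lower_set_def finite_ari_support)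

lemma lower_basis_Op:
  "lower_basis j (Op a b) = (\<Sum>i\<le>j. star (lower_basis i a) (lower_basis (j - i) b))"
proof -
  let ?n = "length (letters a)"
  let ?f = "\<lambda>(i, l, l'). scale_span (ari_mult (letters a) l * ari_mult (letters b) l')
    (basis (Op (relabel a l) (relabel b l')))"
  let ?S = "SIGMA i:{..j}. lower_set i a \<times> lower_set (j - i) b"
  have "(\<Sum>i\<le>j. star (lower_basis i a) (lower_basis (j - i) b)) =
    (\<Sum>i\<le>j. \<Sum>l\<in>lower_set i a. \<Sum>l'\<in>lower_set (j - i) b. ?f (i, l, l'))"
    by (simp add: lower_basis_def star_sum_left star_sum_right star_scale_left star_scale_right
        span_vs.scale_sum_right mult.commute, rule sum.cong[OF refl], rule sum.swap)
  also have "\<dots> = (\<Sum>i\<le>j. \<Sum>p\<in>lower_set i a \<times> lower_set (j - i) b. ?f (i, p))"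
    by (simp add: sum.cartesian_product)
  also have "\<dots> = sum ?f ?S"
    by (subst sum.Sigma) (auto simp: finite_lower_set)
  also have "\<dots> = lower_basis j (Op a b)"
    unfolding lower_basis_def
  proof (rule sum.reindex_bij_witness
      [where j = "\<lambda>(i, l, l'). l @ l'"
        and i = "\<lambda>l. (sum_list (letters a) - sum_list (take ?n l), take ?n l, drop ?n l)"])
    fix p assume "p \<in> ?S"
    then obtain i l l' where p: "p = (i, l, l')" and i: "i \<le> j"
      and l: "l \<in> lower_set i a" and l': "l' \<in> lower_set (j - i) b"
      by auto
    have len: "length l = ?n" using l by (simp add: lower_set_def ari_support_def)
    have sums: "sum_list l + i = sum_list (letters a)"
      "sum_list l' + (j - i) = sum_list (letters b)"
      using l l' by (auto simp: lower_set_def)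
    show "(\<lambda>l. (sum_list (letters a) - sum_list (take ?n l), take ?n l, drop ?n l))
      ((\<lambda>(i, l, l'). l @ l') p) = p"
      using len sums by (simp add: p)
    show "(\<lambda>(i, l, l'). l @ l') p \<in> lower_set j (Op a b)"
      using l l' i sums len by (auto simp: p lower_set_def ari_support_def ari_mult_append)
    show "scale_span (ari_mult (letters (Op a b)) ((\<lambda>(i, l, l'). l @ l') p))
        (basis (relabel (Op a b) ((\<lambda>(i, l, l'). l @ l') p))) = ?f p"
      using len by (simp add: p ari_mult_append)
  next
    fix l assume l: "l \<in> lower_set j (Op a b)"
    let ?l = "take ?n l" and ?l' = "drop ?n l"
    have len: "length ?l = ?n" "length ?l' = length (letters b)"
      using l by (auto simp: lower_set_def ari_support_def)
    have ll: "l = ?l @ ?l'" by simp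
    have "ari_mult (letters a @ letters b) (?l @ ?l') \<noteq> 0"
      using l by (simp add: lower_set_def ari_support_def)
    then have supp: "?l \<in> ari_support (letters a)" "?l' \<in> ari_support (letters b)"
      using len by (auto simp only: ari_support_def ari_mult_append[OF len(1)] mult_eq_0_iff
          mem_Collect_eq)
    have "sum_list (?l @ ?l') + j = sum_list (letters a @ letters b)"
      using l by (simp add: lower_set_def)
    then have sums: "sum_list ?l + sum_list ?l' + j = sum_list (letters a) + sum_list (letters b)"
      by (simp only: sum_list_append)
    note le = ari_support_sum_le[OF supp(1)] ari_support_sum_le[OF supp(2)]
    show "(sum_list (letters a) - sum_list ?l, ?l, ?l') \<in> ?S"
      using supp sums le by (auto simp: lower_set_def)
    show "(\<lambda>(i, l, l'). l @ l') (sum_list (letters a) - sum_list ?l, ?l, ?l') = l"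
      by simp
  qed
  finally show ?thesis by simp
qed

lemma lower_add: "lower j (x + y) = lower j x + lower j y"
  and lower_scale: "lower j (scale_span c x) = scale_span c (lower j x)"
  and lower_zero [simp]: "lower j 0 = 0"
  and lower_basis [simp]: "lower j (basis t) = lower_basis j t"
  by (simp_all add: lower_def extend_linear_add extend_linear_scale)

lemma lower_star: "lower j (star x y) = (\<Sum>i\<le>j. star (lower i x) (lower (j - i) y))"
proof (induction x rule: span_induct)
  case (basis a)
  show ?case
  proof (induction y rule: span_induct)
    case (basis b)
    show ?case by (simp add: lower_basis_Op)
  qed (simp_all add: lower_add star_add_right lower_scale star_scale_right sum.distrib
      span_vs.scale_sum_right)
qed (simp_all add: lower_add star_add_left lower_scale star_scale_left sum.distrib
    span_vs.scale_sum_right)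

text \<open>Coefficient form of an identity of formal series: sums over \<open>i + k = j\<close> are symmetric.\<close>

lemma sum_swap_index: "(\<Sum>i\<le>j. f i (j - i)) = (\<Sum>i\<le>(j::nat). f (j - i) i)"
  by (rule sum.reindex_bij_witness[where i = "\<lambda>i. j - i" and j = "\<lambda>i. j - i"]) auto

definition triples :: "nat \<Rightarrow> (nat \<times> nat \<times> nat) set"
  where "triples j = {(p, q, r). p + q + r = j}"

lemma lower_star_star:
  "lower j (star x (star y z)) =
    (\<Sum>(p, q, r)\<in>triples j. star (lower p x) (star (lower q y) (lower r z)))"
proof -
  have "lower j (star x (star y z)) =
    (\<Sum>p\<le>j. \<Sum>q\<le>j - p. star (lower p x) (star (lower q y) (lower (j - p - q) z)))"
    by (simp add: lower_star star_sum_right)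
  also have "\<dots> = (\<Sum>(p, q)\<in>(SIGMA p:{..j}. {..j - p}).
      star (lower p x) (star (lower q y) (lower (j - p - q) z)))"
    by (simp add: sum.Sigma)
  also have "\<dots> = (\<Sum>(p, q, r)\<in>triples j. star (lower p x) (star (lower q y) (lower r z)))"
    by (rule sum.reindex_bij_witness[where j = "\<lambda>(p, q). (p, q, j - p - q)"
          and i = "\<lambda>(p, q, r). (p, q)"]) (auto simp: triples_def)
  finally show ?thesis .
qed

lemma lower_ideal: "x \<in> lie_ideal \<Longrightarrow> lower j x \<in> lie_ideal"
proof (induction arbitrary: j rule: lie_ideal.induct)
  case (square x)
  let ?s = "\<Sum>i\<le>j. star (lower i x) (lower (j - i) x)"
  have "?s + ?s = (\<Sum>i\<le>j. star (lower i x) (lower (j - i) x) + star (lower (j - i) x) (lower i x))"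
    using sum_swap_index[of "\<lambda>a b. star (lower a x) (lower b x)" j] by (simp add: sum.distrib)
  also have "\<dots> \<in> lie_ideal" by (intro lie_ideal_sum lie_ideal_antisym)
  finally have "scale_span (1/2) (?s + ?s) \<in> lie_ideal" by (rule lie_ideal.scale)
  moreover have "scale_span (1/2) (?s + ?s) = ?s"
    by (simp only: span_vs.scale_right_distrib span_vs.scale_left_distrib[symmetric]) simp
  ultimately show ?case by (simp add: lower_star)
next
  case (jacobi x y z)
  have 1: "lower j (star y (star z x)) =
      (\<Sum>(p, q, r)\<in>triples j. star (lower q y) (star (lower r z) (lower p x)))"
    unfolding lower_star_star
    by (rule sum.reindex_bij_witness[where j = "\<lambda>(q, r, p). (p, q, r)"
          and i = "\<lambda>(p, q, r). (q, r, p)"]) (auto simp: triples_def)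
  have 2: "lower j (star z (star x y)) =
      (\<Sum>(p, q, r)\<in>triples j. star (lower r z) (star (lower p x) (lower q y)))"
    unfolding lower_star_star
    by (rule sum.reindex_bij_witness[where j = "\<lambda>(r, p, q). (p, q, r)"
          and i = "\<lambda>(p, q, r). (r, p, q)"]) (auto simp: triples_def)
  show ?case
    unfolding lower_add 1 2 unfolding lower_star_star sum.distrib[symmetric]
    by (rule lie_ideal_sum) (auto intro: lie_ideal.jacobi)
qed (auto simp: lower_add lower_scale lower_star intro: lie_ideal.intros intro!: lie_ideal_sum)

lemma tri_basis_Letter:
  assumes "s \<noteq> 0" "sum_list (letters t) \<le> N"
  shows "tri_basis t (Letter s) = (\<Sum>j\<le>N. star (basis (Letter (s + j))) (lower_basis j t))"
proof -
  let ?k = "letters t"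
  let ?f = "\<lambda>l. scale_span (ari_mult ?k l)
        (star (basis (Letter (s + sum_list ?k - sum_list l))) (basis (relabel t l)))"
  have "tri_basis t (Letter s) = sum ?f (ari_support ?k)" using assms by simp
  also have "\<dots> = (\<Sum>j\<le>N. sum ?f {l \<in> ari_support ?k. sum_list ?k - sum_list l = j})"
    by (rule sum.group[symmetric]) (use assms in \<open>auto simp: finite_ari_support\<close>)
  also have "\<dots> = (\<Sum>j\<le>N. star (basis (Letter (s + j))) (lower_basis j t))"
  proof (rule sum.cong[OF refl])
    fix j
    have "{l \<in> ari_support ?k. sum_list ?k - sum_list l = j} = lower_set j t"
      using ari_support_sum_le by (fastforce simp: lower_set_def)
    then show "sum ?f {l \<in> ari_support ?k. sum_list ?k - sum_list l = j} =
        star (basis (Letter (s + j))) (lower_basis j t)"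
      unfolding lower_basis_def star_sum_right star_scale_right
    proof (intro sum.cong)
      fix l assume "l \<in> lower_set j t"
      then have "sum_list ?k = sum_list l + j" by (simp add: lower_set_def)
      then have "s + sum_list ?k - sum_list l = s + j" by linarith
      then show "?f l = scale_span (ari_mult ?k l)
          (star (basis (Letter (s + j))) (basis (relabel t l)))"
        by simp
    qed
  qed
  finally show ?thesis .
qed

lemma tri_span_ideal_left: "x \<in> lie_ideal \<Longrightarrow> tri_span x y \<in> lie_ideal"
proof (induction y rule: span_induct)
  case (basis u)
  then show ?case
  proof (induction u)
    case (Letter s)
    let ?N = "Max (insert 0 ((\<lambda>t. sum_list (letters t)) ` Poly_Mapping.keys x))"
    show ?case
    proof (cases "s = 0")
      case True
      then show ?thesis by (simp add: tri_span_def lie_ideal.zero)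
    next
      case False
      have "tri_span x (basis (Letter s)) =
          (\<Sum>t\<in>Poly_Mapping.keys x. scale_span (Poly_Mapping.lookup x t) (tri_basis t (Letter s)))"
        by (simp only: tri_span_def extend_linear_single span_vs.scale_one
            extend_linear_def[of "\<lambda>t. tri_basis t (Letter s)"])
      also have "\<dots> = (\<Sum>t\<in>Poly_Mapping.keys x. scale_span (Poly_Mapping.lookup x t)
          (\<Sum>j\<le>?N. star (basis (Letter (s + j))) (lower_basis j t)))"
        by (intro sum.cong refl arg_cong[where f = "scale_span _"] tri_basis_Letter False) auto
      also have "\<dots> = (\<Sum>j\<le>?N. star (basis (Letter (s + j))) (lower j x))"
        unfolding lower_def extend_linear_def star_sum_right star_scale_right span_vs.scale_sum_right
        by (rule sum.swap)
      also have "\<dots> \<in> lie_ideal"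
        using Letter by (intro lie_ideal_sum lie_ideal.left lower_ideal)
      finally show ?thesis .
    qed
  next
    case (Op a b)
    have "tri_span x (basis (Op a b)) =
        star (tri_span x (basis a)) (basis b) + star (basis a) (tri_span x (basis b))"
      by (metis star_basis tri_span_star)
    then show ?case using Op by (auto intro: lie_ideal.intros)
  qed
qed (auto simp: tri_span_add_right tri_span_scale_right intro: lie_ideal.intros)

lift_definition tri_a :: "nat free_lie \<Rightarrow> nat free_lie \<Rightarrow> nat free_lie" is tri_span
proof -
  fix a b c d :: "nat magma_span"
  assume "lie_rel a b" "lie_rel c d"
  then have "tri_span (a - b) c + tri_span b (c - d) \<in> lie_ideal"
    unfolding lie_rel_def by (intro lie_ideal.add tri_span_ideal_left tri_span_ideal_right)
  then show "lie_rel (tri_span a c) (tri_span b d)"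
    by (simp add: lie_rel_def tri_span_diff_left tri_span_diff_right)
qed

lemma Lie_add: "Lie (x + y) = Lie x + Lie y"
  by (simp add: plus_free_lie.abs_eq)

lemma Lie_scale: "Lie (scale_span c x) = scale_lie c (Lie x)"
  by (simp add: scale_lie.abs_eq)

lemma Lie_star: "Lie (star x y) = bracket (Lie x) (Lie y)"
  by (simp add: bracket.abs_eq)

lemma Lie_tri_span: "Lie (tri_span x y) = tri_a (Lie x) (Lie y)"
  by (simp add: tri_a.abs_eq)

end

theory Submission
  imports Defs
begin

text \<open>Write \<open>v\<^sub>s\<close> for the letters and \<open>L\<^sub>j\<close> for \<open>lower j\<close>, so that
  \<open>x \<triangleright> v\<^sub>s = \<Sum>\<^sub>j v\<^sub>s\<^sub>+\<^sub>j \<star> L\<^sub>j x\<close> for \<open>s \<ge> 1\<close>. The map \<open>L\<^sub>1\<close> is a derivation of the free magma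
  algebra with \<open>(n + 1) L\<^sub>n\<^sub>+\<^sub>1 = L\<^sub>1 L\<^sub>n\<close>, and a computation on letters shows that \<open>L\<^sub>1\<close>, hence every
  \<open>L\<^sub>n\<close>, commutes with \<open>x \<triangleright> _\<close>. Both sides of the post-Lie identity differ by a derivation in
  the last argument; on a letter \<open>v\<^sub>s\<close> the terms \<open>v\<^sub>s\<^sub>+\<^sub>j \<star> (x \<triangleright> L\<^sub>j y)\<close> of \<open>x \<triangleright> (y \<triangleright> v\<^sub>s)\<close> cancel
  \<open>(x \<triangleright> y) \<triangleright> v\<^sub>s\<close>, and what remains is the Jacobi identity.\<close>

section \<open>The lowering maps\<close>

lemma lower_sum: "lower j (sum f A) = (\<Sum>a\<in>A. lower j (f a))"
  by (simp add: lower_def extend_linear_sum)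

lemma tri_span_sum_right: "tri_span x (sum f A) = (\<Sum>a\<in>A. tri_span x (f a))"
  by (induction A rule: infinite_finite_induct) (auto simp: tri_span_add_right)

text \<open>The only candidate label is \<open>[k - j]\<close>; its coefficient \<open>k - 1\<close>
  over \<open>k - j - 1\<close> is turned around by symmetry. The bound \<open>j < k\<close> is
  strict because \<open>ari_binom k 0 = 0\<close> for \<open>k > 0\<close>: a positive letter never
  drops to index 0.\<close>

lemma lower_basis_Letter:
  "lower_basis j (Letter k) =
    (if j = 0 then basis (Letter k)
     else if j < k then scale_span ((-1) ^ j * of_nat ((k - 1) choose j)) (basis (Letter (k - j)))
     else 0)"
proof -
  have supp: "lower_set j (Letter k) =
    (if j = 0 then {[k]} else if j < k then {[k - j]} else {})"
  proof -
    have "l \<in> lower_set j (Letter k) \<longleftrightarrow> (\<exists>m. l = [m] \<and> ari_binom k m \<noteq> 0 \<and> m + j = k)" for l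
      by (auto simp: lower_set_def ari_support_def length_Suc_conv ari_mult_def)
    moreover have "ari_binom k k \<noteq> 0" by (cases k) auto
    moreover have "ari_binom k (k - j) \<noteq> 0 \<longleftrightarrow> j < k" if "0 < j" "j \<le> k"
      using that by (cases k; cases "k - j") auto
    ultimately show ?thesis
      by (auto 0 3 simp: set_eq_iff)
  qed
  have coeff: "ari_mult [k] [k - j] = (-1) ^ j * of_nat ((k - 1) choose j)" if "0 < j" "j < k"
  proof -
    from that obtain l where k: "k = Suc (l + j)"
      by (metis add.commute add_Suc_right less_imp_Suc_add)
    have "(-1::rat) ^ (k + (k - j)) = (-1) ^ j"
      by (simp add: k power_add flip: power_mult_distrib)
    moreover have "ari_binom k (k - j) = (k - 1) choose j"
      using binomial_symmetric[of j "l + j"] by (simp add: k)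
    ultimately show ?thesis by (simp add: ari_mult_def)
  qed
  have diag: "ari_mult [k] [k] = 1"
    by (cases k) (simp_all add: ari_mult_def flip: power_mult_distrib power_add mult_2)
  show ?thesis by (simp add: lower_basis_def supp coeff diag)
qed

lemma lower_0 [simp]: "lower 0 x = x"
proof (induction x rule: span_induct)
  case (basis t)
  show ?case by (induction t) (simp_all add: lower_basis_Letter lower_basis_Op)
qed (simp_all add: lower_add lower_scale)

section \<open>L_1 as a derivation and L_n as its divided powers\<close>

lemma lower_1_star: "lower 1 (star x y) = star (lower 1 x) y + star x (lower 1 y)"
  by (simp add: lower_star atMost_Suc add.commute)

text \<open>The product rule for formal series at coefficient \<open>n\<close>: the weight splits as
  \<open>Suc n = i + (Suc n - i)\<close>, and the terms added by the index shifts have weight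
  0.\<close>

lemma scale_span_weighted_sum:
  fixes f :: "nat \<Rightarrow> nat \<Rightarrow> ('a \<Rightarrow>\<^sub>0 rat)"
  shows "scale_span (of_nat (Suc n)) (\<Sum>i\<le>Suc n. f i (Suc n - i)) =
    (\<Sum>i\<le>n. scale_span (of_nat (Suc i)) (f (Suc i) (n - i)) +
      scale_span (of_nat (Suc (n - i))) (f i (Suc (n - i))))"
proof -
  have 1: "(\<Sum>i\<le>n. scale_span (of_nat (Suc i)) (f (Suc i) (n - i))) =
    (\<Sum>i\<le>Suc n. scale_span (of_nat i) (f i (Suc n - i)))"
    by (subst sum.atMost_Suc_shift) simp
  have 2: "(\<Sum>i\<le>n. scale_span (of_nat (Suc (n - i))) (f i (Suc (n - i)))) =
    (\<Sum>i\<le>Suc n. scale_span (of_nat (Suc n - i)) (f i (Suc n - i)))"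
    by (simp add: Suc_diff_le add_diff_eq)
  show ?thesis
    unfolding sum.distrib 1 2 unfolding sum.distrib[symmetric] span_vs.scale_sum_right
    by (intro sum.cong refl)
      (simp del: of_nat_Suc add: span_vs.scale_left_distrib[symmetric] of_nat_add[symmetric])
qed

text \<open>On letters this is the absorption identity for binomials; on products both sides obey
  the same product rule. Hence L_n is L_1^n / n!.\<close>

lemma lower_1_lower: "lower 1 (lower n x) = scale_span (of_nat (Suc n)) (lower (Suc n) x)"
proof (induction x rule: span_induct)
  case (basis t)
  show ?case
  proof (induction t arbitrary: n)
    case (Letter k)
    show ?case
    proof (cases "Suc n < k")
      case True
      then obtain m where k: "k = Suc (Suc (n + m))"
        by (metis add_Suc less_imp_Suc_add)
      have absorb: "of_nat (Suc n) * of_nat (Suc (n + m) choose Suc n) =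
        (of_nat (Suc m) * of_nat (Suc (n + m) choose n) :: rat)"
        using binomial_absorb_comp[of "Suc (n + m)" n]
        by (simp only: of_nat_mult[symmetric] binomial_absorption) (simp add: Suc_diff_le)
      have coeff: "(-1) ^ n * of_nat (Suc (n + m) choose n) * - of_nat (Suc m) =
        (of_nat (Suc n) * ((-1) ^ Suc n * of_nat (Suc (n + m) choose Suc n)) :: rat)"
        using arg_cong[OF absorb, of "\<lambda>c. - ((-1) ^ n * c)"]
        by (simp add: mult_ac del: of_nat_Suc binomial_Suc_Suc)
      \<comment> \<open>\<open>lower_0\<close> settles \<open>n = 0\<close>, where the letter
        formula takes its other form.\<close>
      show ?thesis
      proof (cases "n = 0")
        case False
        have "lower 1 (lower n (basis (Letter k))) =
          scale_span ((-1) ^ n * of_nat (Suc (n + m) choose n) * - of_nat (Suc m))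
            (basis (Letter (Suc m)))"
          using False by (simp add: lower_basis_Letter lower_scale k del: binomial_Suc_Suc of_nat_Suc)
        also have "\<dots> = scale_span (of_nat (Suc n)) (lower (Suc n) (basis (Letter k)))"
          unfolding coeff
          by (simp add: lower_basis_Letter k del: binomial_Suc_Suc of_nat_Suc power_Suc)
        finally show ?thesis .
      qed (simp del: lower_basis)
    next
      \<comment> \<open>Both sides vanish; for \<open>k = Suc n\<close> because L_1 kills the letter
        of index 1.\<close>
      case False
      then show ?thesis by (auto simp: lower_basis_Letter lower_scale)
    qed
  next
    case (Op a b)
    have "lower 1 (lower n (basis (Op a b))) =
      (\<Sum>i\<le>n. star (lower 1 (lower i (basis a))) (lower (n - i) (basis b)) +
         star (lower i (basis a)) (lower 1 (lower (n - i) (basis b))))"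
      by (simp only: star_basis[symmetric] lower_star[of n] lower_sum lower_1_star)
    also have "\<dots> = scale_span (of_nat (Suc n))
        (\<Sum>i\<le>Suc n. star (lower i (basis a)) (lower (Suc n - i) (basis b)))"
      unfolding Op star_scale_left star_scale_right
      by (rule scale_span_weighted_sum[symmetric])
    also have "\<dots> = scale_span (of_nat (Suc n)) (lower (Suc n) (basis (Op a b)))"
      by (simp only: star_basis[symmetric] lower_star)
    finally show ?case .
  qed
qed (simp_all only: lower_add lower_scale lower_zero span_vs.scale_right_distrib
    span_vs.scale_left_commute span_vs.scale_zero_right)

section \<open>Truncation of the series in j\<close>

lemma eventually_lower_eq_0: "\<forall>\<^sub>F N in sequentially. \<forall>j>N. lower j x = 0"
proof (induction x rule: span_induct)
  case (add x y)
  then show ?case by eventually_elim (simp add: lower_add)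
next
  case (scale c x)
  then show ?case by eventually_elim (simp add: lower_scale)
next
  case (basis t)
  have "lower_basis j t = 0" if "sum_list (letters t) < j" for j
    using that by (auto simp: lower_basis_def lower_set_def intro: sum.neutral)
  then show ?case
    by (auto simp: eventually_sequentially intro!: exI[of _ "sum_list (letters t)"])
qed simp

text \<open>One truncation serves every \<open>s\<close>; stating it for all large \<open>N\<close>
  lets the bounds for several elements merge into one.\<close>

lemma eventually_tri_span_Letter:
  "\<forall>\<^sub>F N in sequentially. \<forall>s>0. tri_span x (basis (Letter s)) =
    (\<Sum>j\<le>N. star (basis (Letter (s + j))) (lower j x))"
proof (induction x rule: span_induct)
  case (add x y)
  then show ?case
    by eventually_elim (simp add: lower_add tri_span_add_left star_add_right sum.distrib)
next
  case (scale c x)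
  then show ?case
    by eventually_elim
      (simp add: lower_scale tri_span_scale_left star_scale_right span_vs.scale_sum_right)
next
  case (basis t)
  show ?case
    unfolding eventually_sequentially
    by (auto intro!: exI[of _ "sum_list (letters t)"]
        simp: tri_basis_Letter simp del: tri_basis.simps)
qed simp

text \<open>For \<open>s = Suc m\<close>, L_1 contributes \<open>- (m + j)\<close> from the letter
  of index \<open>s + j\<close> and, after a shift, \<open>j\<close> from L_1 L_j = (j + 1) L_(j+1).
  The total \<open>- m\<close> is the factor with which L_1 sends the letter \<open>s\<close> to the
  letter \<open>m\<close>.\<close>

lemma lower_1_tri_span: "lower 1 (tri_span x y) = tri_span x (lower 1 y)"
proof (induction y rule: span_induct)
  case (basis t)
  show ?case
  proof (induction t)
    case (Letter s)
    show ?case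
    proof (cases s)
      case 0
      then show ?thesis
        by (simp add: lower_basis_Letter tri_span_def)
    next
      case (Suc m)
      let ?v = "\<lambda>k. basis (Letter k)"
      have "\<forall>\<^sub>F N in sequentially. \<forall>s>0. tri_span x (?v s) =
        (\<Sum>j\<le>Suc N. star (?v (s + j)) (lower j x))"
        using eventually_tri_span_Letter[of x] by (subst eventually_sequentially_Suc)
      with eventually_tri_span_Letter[of x]
      have "\<forall>\<^sub>F N in sequentially. lower 1 (tri_span x (?v s)) = tri_span x (lower 1 (?v s))"
        using eventually_lower_eq_0[of x]
      proof eventually_elim
        case (elim N)
        let ?f = "\<lambda>j. star (?v (m + j)) (lower j x)"
        \<comment> \<open>At \<open>k = 0\<close> the coefficient is 0, so the vanishing case is
          included.\<close>
        have v: "lower 1 (?v (Suc k)) = scale_span (- of_nat k) (?v k)" for k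
          by (cases k) (simp_all add: lower_basis_Letter)
        have "lower 1 (tri_span x (?v s)) =
          (\<Sum>j\<le>N. scale_span (- of_nat (m + j)) (?f j)) +
          (\<Sum>j\<le>N. scale_span (of_nat (Suc j)) (?f (Suc j)))"
          using elim(1)
          by (simp only: Suc zero_less_Suc lower_sum lower_1_star v add_Suc lower_1_lower
              star_scale_left star_scale_right sum.distrib add_Suc_right)
        also have "(\<Sum>j\<le>N. scale_span (of_nat (Suc j)) (?f (Suc j))) =
          (\<Sum>j\<le>Suc N. scale_span (of_nat j) (?f j))"
          by (subst sum.atMost_Suc_shift) simp
        also have "\<dots> = (\<Sum>j\<le>N. scale_span (of_nat j) (?f j))"
          using elim(3) by simp
        also have "(\<Sum>j\<le>N. scale_span (- of_nat (m + j)) (?f j)) + \<dots> =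
          scale_span (- of_nat m) (\<Sum>j\<le>N. ?f j)"
          unfolding sum.distrib[symmetric] span_vs.scale_sum_right
          by (intro sum.cong refl) (simp add: span_vs.scale_left_distrib[symmetric])
        \<comment> \<open>The series formula needs a positive index; at \<open>m = 0\<close> the
          factor \<open>m\<close> kills both sides.\<close>
        also have "\<dots> = tri_span x (lower 1 (?v s))"
          using elim(1) by (cases "m = 0") (simp_all only: Suc v tri_span_scale_right
              of_nat_0 minus_zero span_vs.scale_zero_left neq0_conv tri_span_zero_right)
        finally show ?case .
      qed
      then show ?thesis by simp
    qed
  next
    case (Op a b)
    then show ?case
      by (simp only: star_basis[symmetric] tri_span_star lower_1_star lower_add tri_span_add_right)
        (simp add: algebra_simps)
  qed
qed (simp_all add: lower_add lower_scale tri_span_add_right tri_span_scale_right)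

text \<open>Dividing by \<open>Suc n\<close> over the rationals carries the commutation from L_1 to
  its divided powers.\<close>

lemma lower_tri_span: "lower n (tri_span x y) = tri_span x (lower n y)"
proof (induction n)
  case (Suc n)
  have "scale_span (of_nat (Suc n)) (lower (Suc n) (tri_span x y)) =
    scale_span (of_nat (Suc n)) (tri_span x (lower (Suc n) y))"
    by (simp only: lower_1_lower[symmetric] Suc lower_1_tri_span tri_span_scale_right[symmetric])
  then show ?case
    using span_vs.scale_left_imp_eq by (metis of_nat_eq_0_iff nat.distinct(1))
qed simp

section \<open>The Lie algebra and the post-Lie identity\<close>

lemma Lie_eq_0_iff: "Lie x = 0 \<longleftrightarrow> x \<in> lie_ideal"
  by (simp add: zero_free_lie.abs_eq free_lie.abs_eq_iff lie_rel_def)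

lemma Lie_diff: "Lie (x - y) = Lie x - Lie y"
  by (simp add: minus_free_lie.abs_eq)

lemma Lie_surj: "\<exists>x'. x = Lie x'"
  by (induction x rule: free_lie.abs_induct) auto

interpretation lie_vs: vector_space scale_lie
  by standard
    (transfer; simp add: lie_rel_def lie_ideal.zero span_vs.scale_right_distrib
      span_vs.scale_left_distrib)+

lemma bilinear_bracket: "bilinear_product scale_lie bracket"
  by unfold_locales
    (transfer; simp add: lie_rel_def lie_ideal.zero star_add_left star_add_right
      star_scale_left star_scale_right)+

lemma bilinear_tri_a: "bilinear_product scale_lie tri_a"
  by unfold_locales
    (transfer; simp add: lie_rel_def lie_ideal.zero tri_span_add_left tri_span_add_right
      tri_span_scale_left tri_span_scale_right)+

lemma lie_algebra_free_lie: "lie_algebra scale_lie bracket"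
proof -
  interpret bilinear_product scale_lie bracket by (rule bilinear_bracket)
  show ?thesis
    by unfold_locales
      (transfer; simp add: lie_rel_def lie_ideal.square lie_ideal.jacobi)+
qed

section \<open>The post-Lie identity modulo the Lie ideal\<close>

lemma lie_ideal_right_actions:
  "star v (star a b) - star (star v a) b + star (star v b) a \<in> lie_ideal"
proof -
  \<comment> \<open>The Jacobiator, corrected by three antisymmetry elements, the last one inside
    \<open>star a\<close>.\<close>
  have "star v (star a b) - star (star v a) b + star (star v b) a =
    (star v (star a b) + star a (star b v) + star b (star v a)) -
    (star b (star v a) + star (star v a) b) +
    (star (star v b) a + star a (star v b)) - star a (star b v + star v b)"
    by (simp add: star_add_right algebra_simps)
  also have "\<dots> \<in> lie_ideal"
    by (intro lie_ideal_diff lie_ideal.add lie_ideal.jacobi lie_ideal_antisym lie_ideal.left)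
  finally show ?thesis .
qed

text \<open>For \<open>2 * N \<le> M\<close> the triangle \<open>i + j \<le> M\<close> contains the
  square, outside which \<open>f\<close> vanishes.\<close>

lemma sum_antidiagonals_eq_square:
  fixes f :: "nat \<Rightarrow> nat \<Rightarrow> 'a::comm_monoid_add"
  assumes "\<And>i j. N < i \<or> N < j \<Longrightarrow> f i j = 0" "2 * N \<le> M"
  shows "(\<Sum>n\<le>M. \<Sum>i\<le>n. f i (n - i)) = (\<Sum>i\<le>N. \<Sum>j\<le>N. f i j)"
proof -
  have fin: "finite {(i, j). i + j \<le> M}"
    by (rule finite_subset[of _ "{..M} \<times> {..M}"]) auto
  have "(\<Sum>n\<le>M. \<Sum>i\<le>n. f i (n - i)) = (\<Sum>(i, j)\<in>{(i, j). i + j \<le> M}. f i j)"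
    by (rule sum.triangle_reindex_eq[symmetric])
  also have "\<dots> = (\<Sum>(i, j)\<in>{..N} \<times> {..N}. f i j)"
  proof (rule sum.mono_neutral_right[OF fin])
    show "{..N} \<times> {..N} \<subseteq> {(i, j). i + j \<le> M}" using assms(2) by auto
    show "\<forall>p\<in>{(i, j). i + j \<le> M} - {..N} \<times> {..N}. (case p of (i, j) \<Rightarrow> f i j) = 0"
      using assms(1) by (auto; meson not_le)
  qed
  finally show ?thesis by (simp add: sum.cartesian_product)
qed

text \<open>As a function of \<open>z\<close> the defect is a combination of derivations and a
  commutator of two derivations, so letters suffice.\<close>

lemma tri_span_star_left:
  "tri_span (star x y) z - (tri_span x (tri_span y z) - tri_span (tri_span x y) z
    - tri_span y (tri_span x z) + tri_span (tri_span y x) z) \<in> lie_ideal"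
proof (induction z rule: span_induct)
  case zero
  then show ?case by (simp add: lie_ideal.zero)
next
  case (add z w)
  from lie_ideal.add[OF add] show ?case by (simp add: tri_span_add_right algebra_simps)
next
  case (scale c z)
  from lie_ideal.scale[OF scale] show ?case
    by (simp add: tri_span_scale_right span_vs.scale_right_distrib span_vs.scale_right_diff_distrib)
next
  case (basis t)
  show ?case
  proof (induction t)
    case (Letter s)
    let ?v = "\<lambda>k. basis (Letter k)"
    show ?case
    proof (cases "s = 0")
      case True
      then have "tri_span x (?v s) = 0" for x by (simp add: tri_span_def)
      then show ?thesis by (simp add: lie_ideal.zero)
    next
      case False
      let ?R = "\<lambda>N x. \<forall>s>0. tri_span x (?v s) = (\<Sum>j\<le>N. star (?v (s + j)) (lower j x))"
      have "\<exists>N. ?R N x \<and> ?R N y \<and> ?R N (tri_span x y) \<and> ?R N (tri_span y x) \<and>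
          (\<forall>j>N. lower j x = 0) \<and> (\<forall>j>N. lower j y = 0)"
        by (intro eventually_happens'[OF sequentially_bot] eventually_conj
            eventually_tri_span_Letter eventually_lower_eq_0)
      then obtain N where N: "?R N x" "?R N y" "?R N (tri_span x y)" "?R N (tri_span y x)"
        "\<forall>j>N. lower j x = 0" "\<forall>j>N. lower j y = 0"
        by (elim exE conjE) (rule that)
      have "\<exists>M. 2 * N \<le> M \<and> ?R M (star x y)"
        by (intro eventually_happens'[OF sequentially_bot] eventually_conj
            eventually_ge_at_top eventually_tri_span_Letter)
      then obtain M where M: "2 * N \<le> M" "?R M (star x y)"
        by (elim exE conjE) (rule that)
      \<comment> \<open>The derivation rule gives two sums; since L_j commutes with the action of
        \<open>x\<close>, the second is the series of \<open>tri_span x y\<close> acting on the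
        letter.\<close>
      have iter: "tri_span x (tri_span y (?v s)) =
          (\<Sum>j\<le>N. \<Sum>i\<le>N. star (star (?v (s + (i + j))) (lower i x)) (lower j y)) +
          tri_span (tri_span x y) (?v s)"
        if R: "?R N x" "?R N y" "?R N (tri_span x y)" for x y
      proof -
        have "tri_span x (tri_span y (?v s)) =
            (\<Sum>j\<le>N. star (tri_span x (?v (s + j))) (lower j y)) +
            (\<Sum>j\<le>N. star (?v (s + j)) (lower j (tri_span x y)))"
          using R(2) False
          by (simp only: neq0_conv tri_span_sum_right tri_span_star sum.distrib lower_tri_span)
        also have "(\<Sum>j\<le>N. star (?v (s + j)) (lower j (tri_span x y))) =
            tri_span (tri_span x y) (?v s)"
          using R(3) False by (simp only: neq0_conv)
        also have "(\<Sum>j\<le>N. star (tri_span x (?v (s + j))) (lower j y)) =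
            (\<Sum>j\<le>N. \<Sum>i\<le>N. star (star (?v (s + (i + j))) (lower i x)) (lower j y))"
          using R(1) False
          by (simp only: neq0_conv star_sum_left add_gr_0 simp_thms add.assoc add.commute
              add.left_commute)
        finally show ?thesis .
      qed
      \<comment> \<open>The index \<open>n\<close> is written as \<open>i + (n - i)\<close> to fit
        the antidiagonal form.\<close>
      have "tri_span (star x y) (?v s) =
          (\<Sum>n\<le>M. \<Sum>i\<le>n. star (?v (s + (i + (n - i)))) (star (lower i x) (lower (n - i) y)))"
        using M(2) False by (simp add: lower_star star_sum_right)
      also have "\<dots> = (\<Sum>i\<le>N. \<Sum>j\<le>N. star (?v (s + (i + j))) (star (lower i x) (lower j y)))"
        by (rule sum_antidiagonals_eq_square) (use N(5,6) M(1) in auto)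
      finally have star: "tri_span (star x y) (?v s) = \<dots>" .
      \<comment> \<open>The last terms of both uses of \<open>iter\<close> cancel; in the second use
        \<open>i\<close> and \<open>j\<close> trade names.\<close>
      have "tri_span (star x y) (?v s) - (tri_span x (tri_span y (?v s))
          - tri_span (tri_span x y) (?v s) - tri_span y (tri_span x (?v s))
          + tri_span (tri_span y x) (?v s)) =
        (\<Sum>i\<le>N. \<Sum>j\<le>N. star (?v (s + (i + j))) (star (lower i x) (lower j y))) -
        (\<Sum>j\<le>N. \<Sum>i\<le>N. star (star (?v (s + (i + j))) (lower i x)) (lower j y)) +
        (\<Sum>i\<le>N. \<Sum>j\<le>N. star (star (?v (s + (i + j))) (lower j y)) (lower i x))"
        unfolding star iter[OF N(1,2,3)] iter[OF N(2,1,4)] by (simp add: add.commute)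
      also have "\<dots> = (\<Sum>i\<le>N. \<Sum>j\<le>N.
          star (?v (s + (i + j))) (star (lower i x) (lower j y)) -
          star (star (?v (s + (i + j))) (lower i x)) (lower j y) +
          star (star (?v (s + (i + j))) (lower j y)) (lower i x))"
        by (subst sum.swap[of _ "{..N}" "{..N}"]) (simp add: sum.distrib sum_subtractf)
      also have "\<dots> \<in> lie_ideal"
        by (intro lie_ideal_sum lie_ideal_right_actions)
      finally show ?thesis .
    qed
  next
    case (Op a b)
    from lie_ideal.add[OF lie_ideal.right[OF Op(1), of "basis b"]
        lie_ideal.left[OF Op(2), of "basis a"]]
    show ?case
      by (simp only: star_basis[symmetric] tri_span_star tri_span_add_right star_add_left
          star_add_right star_diff_left star_diff_right) (simp add: algebra_simps)
  qed
qed

theorem theorem4p13: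
  shows "post_lie_algebra scale_lie bracket tri_a"
proof -
  interpret lie_algebra scale_lie bracket by (rule lie_algebra_free_lie)
  interpret tri: bilinear_product scale_lie tri_a by (rule bilinear_tri_a)
  show ?thesis
  proof unfold_locales
    fix x y z :: "nat free_lie"
    obtain x' y' z' where [simp]: "x = Lie x'" "y = Lie y'" "z = Lie z'"
      by (metis Lie_surj)
    show "tri_a x (bracket y z) = bracket (tri_a x y) z + bracket y (tri_a x z)"
      by (simp add: tri_span_star flip: Lie_add Lie_star Lie_tri_span)
    have "tri_a (bracket x y) z - (tri_a x (tri_a y z) - tri_a (tri_a x y) z - tri_a y (tri_a x z)
        + tri_a (tri_a y x) z) = 0"
      using tri_span_star_left[of x' y' z']
      by (simp flip: Lie_add Lie_star Lie_tri_span Lie_diff add: Lie_eq_0_iff)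
    then show "tri_a (bracket x y) z = tri_a x (tri_a y z) - tri_a (tri_a x y) z
        - tri_a y (tri_a x z) + tri_a (tri_a y x) z"
      by simp
  qed
qed

end
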